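(* Assume there is a constant $\varepsilon>0$ such that for every composition $\mu$ of $n$ with $\ell(\mu)<n$, every nonempty $C\subseteq\mathrm{Cr}(\mu)$ and every real $r\ge 0$: if $\mathrm{d}(C,C^\vee)\ge r$ then $\frac{|C|}{|\mathrm{Cr}(\mu)|}\le e^{-\varepsilon r^2/(n-\ell(\mu))}$. Then for any nonempty subsets $A,B\subseteq S(n)$, $$\log|M|\ \ge\ \tfrac12\log|A|+\tfrac12\log|B|+\tfrac{K}{8}\,\mathrm{d}(A,B)^2,\qquad K=\frac{4\varepsilon}{n-1},$$ where $M$ is the midpoint set of $A$ and $B$.
   Context: $S(n)$ is the symmetric group on $\{1,\dots,n\}$ ($n\ge 2$), products composed right to left, $e$ the identity, equipped with the graph distance $\mathrm{d}$ of its Cayley graph generated by all transpositions; $\mathrm{d}(a,b)=n-(\text{number of cycles of }a^{-1}b)$. A permutation $m$ is a midpoint of $a$ and $b$ if $\mathrm{d}(a,m)+\mathrm{d}(m,b)=\mathrm{d}(a,b)$ and $\mathrm{d}(a,m)-\mathrm{d}(m,b)\in\{-1,0,1\}$. The midpoint set of $A$ and $B$ is $M=\{m: m\text{ is a midpoint of some }a\in A,\,b\in B\}$. For sets $X,Y\subseteq S(n)$, $\mathrm{d}(X,Y)=\min\{\mathrm{d}(x,y):x\in X,y\in Y\}$. For a composition $\mu=(\mu_1,\dots,\mu_k)$ of $n$ (ordered sequence of positive integers summing to $n$), $\ell(\mu)=k$ is its number of parts, and $p_\mu=(1\mapsto\cdots\mapsto\mu_1)(\mu_1+1\mapsto\cdots\mapsto\mu_1+\mu_2)\cdots$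 is the permutation cyclically shifting each consecutive block of $\mu_i$ integers forward. $\mathrm{Cr}(\mu)$ is the set of midpoints of $e$ and $p_\mu$; for $c\in\mathrm{Cr}(\mu)$, $c^\vee:=c^{-1}p_\mu$, and for $C\subseteq\mathrm{Cr}(\mu)$, $C^\vee:=\{c^\vee:c\in C\}$. $|\cdot|$ denotes cardinality. *)

theory Defs
  imports Complex_Main "HOL-Combinatorics.Combinatorics"
begin

definition Sn :: "nat \<Rightarrow> (nat \<Rightarrow> nat) set" where
  "Sn n = {p. p permutes {1..n}}"

definition cayley_edges :: "nat \<Rightarrow> ((nat \<Rightarrow> nat) \<times> (nat \<Rightarrow> nat)) set" where
  "cayley_edges n =
     {(a, a \<circ> transpose i j) | a i j. a \<in> Sn n \<and> i \<in> {1..n} \<and> j \<in> {1..n} \<and> i \<noteq> j}"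

text \<open>
  The graph distance is the length of a shortest walk; the \<open>LEAST\<close> is meaningful because
  the Cayley graph is connected. On \<open>Sn n\<close> the distance of \<open>a\<close> and \<open>b\<close> equals \<open>n\<close> minus the
  number of cycles of \<open>inv a \<circ> b\<close> on \<open>{1..n}\<close> (fixed points counted).
\<close>
definition cdist :: "nat \<Rightarrow> (nat \<Rightarrow> nat) \<Rightarrow> (nat \<Rightarrow> nat) \<Rightarrow> nat" where
  "cdist n a b = (LEAST k. (a, b) \<in> cayley_edges n ^^ k)"

definition cset_dist :: "nat \<Rightarrow> (nat \<Rightarrow> nat) set \<Rightarrow> (nat \<Rightarrow> nat) set \<Rightarrow> nat" where
  "cset_dist n X Y = Min {cdist n x y | x y. x \<in> X \<and> y \<in> Y}"

definition is_midpoint ::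
  "nat \<Rightarrow> (nat \<Rightarrow> nat) \<Rightarrow> (nat \<Rightarrow> nat) \<Rightarrow> (nat \<Rightarrow> nat) \<Rightarrow> bool" where
  "is_midpoint n a b m \<longleftrightarrow>
     m \<in> Sn n \<and>
     cdist n a m + cdist n m b = cdist n a b \<and>
     int (cdist n a m) - int (cdist n m b) \<in> {-1, 0, 1}"

definition midpoint_set ::
  "nat \<Rightarrow> (nat \<Rightarrow> nat) set \<Rightarrow> (nat \<Rightarrow> nat) set \<Rightarrow> (nat \<Rightarrow> nat) set" where
  "midpoint_set n A B = {m. \<exists>a\<in>A. \<exists>b\<in>B. is_midpoint n a b m}"

definition is_composition :: "nat \<Rightarrow> nat list \<Rightarrow> bool" where
  "is_composition n mu \<longleftrightarrow> (\<forall>k\<in>set mu. 0 < k) \<and> sum_list mu = n"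

text \<open>
  \<open>cycle_of_list [x, y, z]\<close> maps \<open>x\<close> to \<open>y\<close>, \<open>y\<close> to \<open>z\<close> and \<open>z\<close> to \<open>x\<close>. The first
  argument of \<open>block_shift\<close> is the number of integers already used by earlier blocks.
\<close>
fun block_shift :: "nat \<Rightarrow> nat list \<Rightarrow> nat \<Rightarrow> nat" where
  "block_shift s [] = id"
| "block_shift s (k # ks) = cycle_of_list [s + 1..<s + k + 1] \<circ> block_shift (s + k) ks"

definition comp_perm :: "nat list \<Rightarrow> nat \<Rightarrow> nat" where
  "comp_perm mu = block_shift 0 mu"

definition Cr :: "nat \<Rightarrow> nat list \<Rightarrow> (nat \<Rightarrow> nat) set" where
  "Cr n mu = {c. is_midpoint n id (comp_perm mu) c}"

definition dual :: "nat list \<Rightarrow> (nat \<Rightarrow> nat) \<Rightarrow> (nat \<Rightarrow> nat)" where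
  "dual mu c = inv c \<circ> comp_perm mu"

end

theory Submission
  imports Defs
begin

text \<open>
  For \<open>a \<in> A\<close>, \<open>b \<in> B\<close> and a midpoint \<open>c\<close> of \<open>id\<close> and \<open>p = a\<inverse>b\<close>, write \<open>p = c d\<close>. Then
  \<open>m = a c\<close> and \<open>m' = a d\<close> are midpoints of \<open>a\<close> and \<open>b\<close>, and \<open>m\<inverse>m' = c\<inverse>d\<close>. Minimal transposition words
  for \<open>c\<close> and \<open>d\<close> together form a forest on \<open>{1..n}\<close>, and the product of the edges of a forest, taken in any order,
  has the connected components as its orbits. Hence \<open>c\<inverse>d\<close> and \<open>c d\<close> are conjugate, \<open>c\<inverse>\<close> is a midpoint
  of \<open>id\<close> and \<open>c\<inverse>d\<close>, and \<open>((a, b), c) \<mapsto> ((m, m'), c\<inverse>)\<close> is an involution preserving the number of midpoints.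

  The set \<open>C\<close> of those midpoints \<open>c'\<close> of \<open>id\<close> and \<open>m\<inverse>m'\<close> that come from \<open>A \<times> B\<close> satisfies
  \<open>d(C, C\<^sup>\<or>) \<ge> d(A, B)\<close>, because \<open>m c' \<in> A\<close> and \<open>m c'\<^sup>\<or> \<in> B\<close>. Giving every triple the weight
  \<open>1 / |Cr|\<close>, the concentration hypothesis yields \<open>|A| |B| \<le> |M|\<^sup>2 exp (- \<epsilon> d(A, B)\<^sup>2 / (n - 1))\<close>.
\<close>

section \<open>Forests of transpositions, orbits and word length\<close>

definition linked :: "('a \<times> 'a) set \<Rightarrow> ('a \<times> 'a) set" where
  "linked E = (E \<union> E\<inverse>)\<^sup>*"

text \<open>Quotienting \<open>{1..n}\<close> by a relation on the whole type keeps isolated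
  vertices as classes, so the empty edge set has \<open>n\<close> components.\<close>

definition components :: "nat \<Rightarrow> (nat \<times> nat) set \<Rightarrow> nat" where
  "components n E = card ({1..n} // linked E)"

definition swap_word :: "nat \<Rightarrow> (nat \<times> nat) list \<Rightarrow> bool" where
  "swap_word n ws \<longleftrightarrow> set ws \<subseteq> {(i, j). i \<in> {1..n} \<and> j \<in> {1..n} \<and> i \<noteq> j}"

fun swap_prod :: "(nat \<times> nat) list \<Rightarrow> nat \<Rightarrow> nat" where
  "swap_prod [] = id"
| "swap_prod ((i, j) # ws) = transpose i j \<circ> swap_prod ws"

text \<open>Edges are added from the end of the list, each joining two different components. As
  \<open>linked\<close> is reflexive and contains its edges, loops and repeated edges are excluded
  too.\<close>

fun forest :: "('a \<times> 'a) list \<Rightarrow> bool" where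
  "forest [] = True"
| "forest ((x, y) # ws) \<longleftrightarrow> forest ws \<and> (x, y) \<notin> linked (set ws)"

text \<open>Only forward iterates occur: for a permutation of finite support they already form the
  orbit equivalence, but symmetry is not built in.\<close>

definition orb :: "('a \<Rightarrow> 'a) \<Rightarrow> ('a \<times> 'a) set" where
  "orb p = {(x, y). \<exists>k. y = (p ^^ k) x}"

definition swap_length :: "nat \<Rightarrow> (nat \<Rightarrow> nat) \<Rightarrow> nat" where
  "swap_length n p = (LEAST k. \<exists>ws. swap_word n ws \<and> length ws = k \<and> swap_prod ws = p)"

section \<open>Connected components\<close>

lemma equiv_linked: "equiv UNIV (linked E)"
proof -
  have "sym (E \<union> E\<inverse>)" by (auto simp: sym_def)
  then show ?thesis
    unfolding linked_def by (simp add: equiv_def refl_rtrancl sym_rtrancl trans_rtrancl)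
qed

lemma linked_refl [simp]: "(x, x) \<in> linked E"
  by (simp add: linked_def)

lemma linked_sym: "(x, y) \<in> linked E \<Longrightarrow> (y, x) \<in> linked E"
  using equiv_linked[of E] by (meson equiv_def symE)

lemma linked_trans: "(x, y) \<in> linked E \<Longrightarrow> (y, z) \<in> linked E \<Longrightarrow> (x, z) \<in> linked E"
  by (simp add: linked_def)

lemma linked_mono: "E \<subseteq> F \<Longrightarrow> linked E \<subseteq> linked F"
  unfolding linked_def by (rule rtrancl_mono) auto

text \<open>Asking \<open>R\<close> to contain both orientations of each edge, instead of being
  symmetric, makes the bound applicable to \<open>orb p\<close>, whose symmetry is not visible from
  its definition.\<close>

lemma linked_least:
  assumes "E \<union> E\<inverse> \<subseteq> R" "refl R" "trans R"
  shows "linked E \<subseteq> R"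
proof
  fix u assume "u \<in> linked E"
  then obtain a b where u: "u = (a, b)" and "(a, b) \<in> (E \<union> E\<inverse>)\<^sup>*"
    unfolding linked_def by (cases u) auto
  from this(2) have "(a, b) \<in> R"
  proof (induction rule: rtrancl_induct)
    case base
    then show ?case using assms(2) by (simp add: refl_onD)
  next
    case (step y z)
    then show ?case using assms(1) assms(3) by (meson subsetD transE)
  qed
  then show "u \<in> R" by (simp add: u)
qed

lemma linked_insert_redundant:
  assumes "(x, y) \<in> linked E"
  shows "linked (insert (x, y) E) = linked E"
proof
  show "linked (insert (x, y) E) \<subseteq> linked E"
  proof (rule linked_least)
    have "E \<union> E\<inverse> \<subseteq> linked E" by (auto simp: linked_def)
    then show "insert (x, y) E \<union> (insert (x, y) E)\<inverse> \<subseteq> linked E"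
      using assms linked_sym[OF assms] by auto
    show "refl (linked E)" "trans (linked E)"
      by (simp_all add: linked_def refl_rtrancl trans_rtrancl)
  qed
qed (rule linked_mono, auto)

text \<open>\<open>N E\<close> is a union of classes of \<open>linked E\<close>, so an old link
  never leads from inside \<open>N E\<close> to outside; the right-hand side is therefore already
  transitive.\<close>

lemma linked_insert:
  fixes x y :: 'a
  defines "N E \<equiv> linked E `` {x} \<union> linked E `` {y}"
  shows "linked (insert (x, y) E) = linked E \<union> N E \<times> N E"
proof
  show "linked (insert (x, y) E) \<subseteq> linked E \<union> N E \<times> N E"
  proof (rule linked_least)
    show "insert (x, y) E \<union> (insert (x, y) E)\<inverse> \<subseteq> linked E \<union> N E \<times> N E"
      by (auto simp: linked_def N_def)
    show "refl (linked E \<union> N E \<times> N E)" by (auto simp: refl_on_def)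
    show "trans (linked E \<union> N E \<times> N E)"
      unfolding trans_def N_def
      by (auto intro: linked_trans linked_sym)
  qed
next
  let ?L = "linked (insert (x, y) E)"
  have mono: "linked E \<subseteq> ?L" by (rule linked_mono) auto
  have xy: "(x, y) \<in> ?L" by (auto simp: linked_def)
  have "(x, z) \<in> ?L" if "z \<in> N E" for z
    using that mono xy by (auto simp: N_def intro: linked_trans)
  then have "N E \<times> N E \<subseteq> ?L"
    by (auto intro: linked_trans linked_sym)
  then show "linked E \<union> N E \<times> N E \<subseteq> ?L" using mono by auto
qed

text \<open>The classes of \<open>x\<close> and \<open>y\<close> are distinct and both are counted.
  They are replaced by their union, and every other class stays.\<close>

lemma components_insert:
  assumes "x \<in> {1..n}" "y \<in> {1..n}" "(x, y) \<notin> linked E"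
  shows "Suc (components n (insert (x, y) E)) = components n E"
proof -
  let ?L = "linked E" and ?M = "linked (insert (x, y) E)" and ?S = "{1..n}"
  let ?X = "?L `` {x}" and ?Y = "?L `` {y}"
  have ne: "?X \<noteq> ?Y"
  proof
    assume eq: "?X = ?Y"
    have "y \<in> ?Y" by simp
    then show False using assms(3) unfolding eq[symmetric] by simp
  qed
  have cl: "?M `` {z} = (if z \<in> ?X \<union> ?Y then ?X \<union> ?Y else ?L `` {z})" for z
  proof (cases "z \<in> ?X \<union> ?Y")
    case True
    then have "?L `` {z} \<subseteq> ?X \<union> ?Y" by (auto intro: linked_trans)
    then show ?thesis using True unfolding linked_insert by auto
  next
    case False
    then show ?thesis unfolding linked_insert by auto
  qed
  have classes: "?L `` {z} = ?L `` {u}" if "z \<in> ?L `` {u}" for z u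
    using that equiv_class_eq[OF equiv_linked, of u z E] by simp
  have q: "?S // ?M = insert (?X \<union> ?Y) (?S // ?L - {?X, ?Y})"
  proof (intro equalityI subsetI)
    fix V assume "V \<in> ?S // ?M"
    then obtain z where z: "z \<in> ?S" "V = ?M `` {z}" by (auto simp: quotient_def)
    show "V \<in> insert (?X \<union> ?Y) (?S // ?L - {?X, ?Y})"
    proof (cases "z \<in> ?X \<union> ?Y")
      case True
      then show ?thesis using z cl[of z] by simp
    next
      case False
      then have V: "V = ?L `` {z}" using z cl[of z] by simp
      then have "z \<in> V" by simp
      then have "V \<noteq> ?X" "V \<noteq> ?Y" using False by blast+
      moreover have "V \<in> ?S // ?L" unfolding V using z(1) by (rule quotientI)
      ultimately show ?thesis by blast
    qed
  next
    fix V assume "V \<in> insert (?X \<union> ?Y) (?S // ?L - {?X, ?Y})"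
    then consider "V = ?X \<union> ?Y" | z where "z \<in> ?S" "V = ?L `` {z}" "V \<noteq> ?X" "V \<noteq> ?Y"
      unfolding quotient_def by blast
    then show "V \<in> ?S // ?M"
    proof cases
      case 1
      then have "V = ?M `` {x}" using cl[of x] by simp
      then show ?thesis using assms(1) by (auto intro: quotientI)
    next
      case 2
      then have "z \<notin> ?X \<union> ?Y" using classes by blast
      then have "V = ?M `` {z}" using cl[of z] 2 by simp
      then show ?thesis using 2(1) by (auto intro: quotientI)
    qed
  qed
  \<comment> \<open>The union is not among the old classes, so inserting it really adds one to the
    cardinality.\<close>
  have new: "?X \<union> ?Y \<notin> ?S // ?L"
  proof
    assume "?X \<union> ?Y \<in> ?S // ?L"
    then obtain z where z: "?X \<union> ?Y = ?L `` {z}" by (auto simp: quotient_def)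
    have "x \<in> ?X \<union> ?Y" "y \<in> ?X \<union> ?Y" by simp_all
    then have "(z, x) \<in> ?L" "(z, y) \<in> ?L" unfolding z by simp_all
    then show False using assms(3) linked_sym linked_trans by metis
  qed
  have fin: "finite (?S // ?L)" by (simp add: quotient_def)
  have mem: "{?X, ?Y} \<subseteq> ?S // ?L" using assms by (simp add: quotientI)
  have two: "card {?X, ?Y} = 2" unfolding card_2_iff using ne by blast
  have "2 \<le> card (?S // ?L)"
    using card_mono[OF fin mem] unfolding two .
  moreover have "card (?S // ?L - {?X, ?Y}) = card (?S // ?L) - 2"
    using card_Diff_subset[OF _ mem] unfolding two by blast
  moreover have "card (insert (?X \<union> ?Y) (?S // ?L - {?X, ?Y})) = Suc (card (?S // ?L - {?X, ?Y}))"
    using new fin by (intro card_insert_disjoint) blast+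
  ultimately show ?thesis
    unfolding components_def q by linarith
qed

text \<open>Closing a class under the coarser relation gives a coarser class, and every coarser
  class arises in this way.\<close>

lemma components_mono:
  assumes "linked E \<subseteq> linked F"
  shows "components n F \<le> components n E"
proof -
  let ?f = "\<lambda>V. linked F `` V"
  have "?f (linked E `` {z}) = linked F `` {z}" for z
    using assms by (auto intro: linked_trans)
  then have "{1..n} // linked F \<subseteq> ?f ` ({1..n} // linked E)"
    unfolding quotient_def by (force simp: image_iff)
  then show ?thesis
    unfolding components_def by (rule surj_card_le[rotated]) (simp add: quotient_def)
qed

lemma components_empty: "components n {} = n"
proof -
  have "{1..n} // linked {} = (\<lambda>x. {x}) ` {1..n}"
    by (auto simp: quotient_def linked_def)
  then show ?thesis by (simp add: components_def card_image)
qed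

section \<open>Counting the components of a transposition word\<close>

lemma swap_word_Cons [simp]:
  "swap_word n ((i, j) # ws) \<longleftrightarrow> i \<in> {1..n} \<and> j \<in> {1..n} \<and> i \<noteq> j \<and> swap_word n ws"
  by (auto simp: swap_word_def)

lemma swap_word_Nil [simp]: "swap_word n []"
  by (simp add: swap_word_def)

text \<open>A letter lowers the number of components by one if it joins two of them and leaves it
  unchanged otherwise. Hence being a forest depends only on the edge set and the length, not on the
  order of the letters.\<close>

lemma components_word:
  assumes "swap_word n ws"
  shows "n \<le> components n (set ws) + length ws"
    and "forest ws \<longleftrightarrow> components n (set ws) + length ws = n"
proof -
  have "n \<le> components n (set ws) + length ws \<and>
      (forest ws \<longleftrightarrow> components n (set ws) + length ws = n)"
    using assms
  proof (induction ws)
    case Nil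
    then show ?case by (simp add: components_empty)
  next
    case (Cons w ws)
    obtain x y where w: "w = (x, y)" by (cases w)
    show ?case
    proof (cases "(x, y) \<in> linked (set ws)")
      case True
      then have "components n (set (w # ws)) = components n (set ws)"
        by (simp add: w components_def linked_insert_redundant)
      then show ?thesis using Cons True by (auto simp: w)
    next
      case False
      then have "Suc (components n (set (w # ws))) = components n (set ws)"
        using Cons.prems by (simp add: w components_insert)
      then show ?thesis using Cons False by (auto simp: w)
    qed
  qed
  then show "n \<le> components n (set ws) + length ws"
    and "forest ws \<longleftrightarrow> components n (set ws) + length ws = n" by auto
qed

section \<open>Orbits of products of transpositions\<close>

lemma orb_refl: "(x, x) \<in> orb p"
  unfolding orb_def by (auto intro: exI[of _ 0])

lemma orb_step: "(x, y) \<in> orb p \<Longrightarrow> (x, p y) \<in> orb p"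
  unfolding orb_def by (auto intro: exI[of _ "Suc _"])

lemma orb_trans: "(x, y) \<in> orb p \<Longrightarrow> (y, z) \<in> orb p \<Longrightarrow> (x, z) \<in> orb p"
  unfolding orb_def by (auto simp: funpow_add[symmetric, THEN fun_cong, unfolded o_def])
 
lemma orb_least:
  assumes "\<And>x. (x, p x) \<in> R" "refl R" "trans R"
  shows "orb p \<subseteq> R"
proof -
  have "(x, (p ^^ k) x) \<in> R" for x k
    using assms by (induction k) (auto dest: refl_onD transD)
  then show ?thesis by (auto simp: orb_def)
qed

lemma swap_prod_linked: "(x, swap_prod ws x) \<in> linked (set ws)"
proof (induction ws)
  case (Cons w ws)
  obtain i j where w: "w = (i, j)" by (cases w)
  have ij: "(i, j) \<in> linked (set (w # ws))" by (auto simp: w linked_def)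
  have "(x, swap_prod ws x) \<in> linked (set (w # ws))"
    using Cons linked_mono[of "set ws" "set (w # ws)"] by auto
  moreover have "(z, transpose i j z) \<in> linked (set (w # ws))" for z
    using ij by (auto simp: transpose_def intro: linked_sym)
  ultimately show ?case by (auto simp: w intro: linked_trans)
qed simp

lemma orb_subset_linked: "orb (swap_prod ws) \<subseteq> linked (set ws)"
proof (rule orb_least)
  show "refl (linked (set ws))" "trans (linked (set ws))"
    by (simp_all add: linked_def refl_rtrancl trans_rtrancl)
qed (rule swap_prod_linked)

lemma linked_subset_support:
  assumes "E \<subseteq> T \<times> T" "(x, y) \<in> linked E" "x \<noteq> y"
  shows "x \<in> T" "y \<in> T"
proof -
  have "linked E \<subseteq> Id \<union> T \<times> T"
    by (rule linked_least) (use assms(1) in \<open>auto simp: refl_on_def trans_def\<close>)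
  then show "x \<in> T" "y \<in> T" using assms by auto
qed

lemma swap_prod_permutes:
  assumes "swap_word n ws"
  shows "swap_prod ws permutes {1..n}"
  using assms
proof (induction ws)
  case (Cons w ws)
  obtain i j where w: "w = (i, j)" by (cases w)
  then have "i \<in> {1..n}" "j \<in> {1..n}" "swap_prod ws permutes {1..n}" using Cons by auto
  then show ?case
    unfolding w swap_prod.simps by (intro permutes_compose permutes_swap_id)
qed (simp add: permutes_id)

text \<open>
  If \<open>x\<close> did not reach \<open>y\<close> under \<open>transpose x y \<circ> p\<close>, this map would send the finite set of points
  that are reached from \<open>x\<close> and lie in the old component of \<open>x\<close> injectively into itself minus \<open>x\<close>.
\<close>

lemma orb_transpose_merge:
  assumes "inj p" "finite W" "x \<in> W" "y \<notin> W" "p ` W \<subseteq> W"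
  shows "(x, y) \<in> orb (transpose x y \<circ> p)"
proof (rule ccontr)
  let ?q = "transpose x y \<circ> p"
  assume nxy: "(x, y) \<notin> orb ?q"
  define V where "V = {z \<in> W. (x, z) \<in> orb ?q}"
  have "finite V" "x \<in> V" using assms by (auto simp: V_def orb_refl)
  have "?q z \<in> V - {x}" if "z \<in> V" for z
  proof -
    have z: "z \<in> W" "(x, ?q z) \<in> orb ?q" using that orb_step[of x z ?q] by (auto simp: V_def)
    have "p z \<in> W" using z assms by auto
    then have "p z \<noteq> y" using assms by auto
    \<comment> \<open>If \<open>p z\<close> were \<open>x\<close>, then \<open>?q z\<close> would be
      \<open>y\<close>; so the unreachability of \<open>y\<close> also rules out
      \<open>p z = x\<close>.\<close>
    have "?q z \<noteq> y" using z nxy by auto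
    then have "p z \<noteq> x" by auto
    then have "?q z = p z" using \<open>p z \<noteq> y\<close> by simp
    then show ?thesis using z \<open>p z \<in> W\<close> \<open>p z \<noteq> x\<close> by (auto simp: V_def)
  qed
  then have "?q ` V \<subseteq> V - {x}" by auto
  moreover have "inj_on ?q V"
    using assms(1) by (intro inj_on_subset[OF inj_compose]) auto
  ultimately have "card V \<le> card (V - {x})"
    using \<open>finite V\<close> by (metis card_image card_mono finite_Diff)
  moreover have "card (V - {x}) < card V"
    using \<open>finite V\<close> \<open>x \<in> V\<close> by (rule card_Diff1_less)
  ultimately show False by simp
qed

text \<open>The new letter joins two components, so by \<open>orb_transpose_merge\<close> its ends
  reach each other under the new product. A step of the old product is then a step of the new one
  followed by at most one move between \<open>x\<close> and \<open>y\<close>.\<close>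

lemma linked_subset_orb:
  assumes "swap_word n ws" "forest ws"
  shows "linked (set ws) \<subseteq> orb (swap_prod ws)"
  using assms
proof (induction ws)
  case Nil
  show ?case by (auto simp: linked_def orb_refl)
next
  case (Cons w ws)
  obtain x y where w: "w = (x, y)" by (cases w)
  have xy: "x \<in> {1..n}" "y \<in> {1..n}" "(x, y) \<notin> linked (set ws)" "swap_word n ws" "forest ws"
    using Cons.prems by (auto simp: w)
  let ?p = "swap_prod ws" and ?q = "swap_prod (w # ws)"
  have inj: "inj ?p" using swap_prod_permutes[OF xy(4)] by (rule permutes_inj)
  \<comment> \<open>Stated for arbitrary ends because it is needed from \<open>x\<close> to
    \<open>y\<close> and, the transposition being symmetric, from \<open>y\<close> to
    \<open>x\<close>. The invariant set is the old component of the start.\<close>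
  have merge: "(u, v) \<in> orb (transpose u v \<circ> ?p)"
    if "u \<in> {1..n}" "(u, v) \<notin> linked (set ws)" for u v
  proof (rule orb_transpose_merge[OF inj])
    let ?W = "linked (set ws) `` {u}"
    have "set ws \<subseteq> {1..n} \<times> {1..n}" using xy(4) by (auto simp: swap_word_def)
    then have "?W \<subseteq> {1..n}"
      using linked_subset_support[of "set ws" "{1..n}" u] that(1) by blast
    then show "finite ?W" by (rule finite_subset) simp
    show "u \<in> ?W" "v \<notin> ?W" using that by auto
    show "?p ` ?W \<subseteq> ?W" using swap_prod_linked by (auto intro: linked_trans)
  qed
  have 1: "(x, y) \<in> orb ?q" using merge[of x y] xy by (simp add: w)
  have 2: "(y, x) \<in> orb ?q"
    using merge[of y x] xy linked_sym[of y x] by (auto simp: w transpose_commute)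
  have rt: "refl (orb ?q)" "trans (orb ?q)"
    by (auto simp: refl_on_def trans_def orb_refl intro: orb_trans)
  have "orb ?p \<subseteq> orb ?q"
  proof (rule orb_least[OF _ rt])
    fix z
    have z: "(z, ?q z) \<in> orb ?q" by (rule orb_step[OF orb_refl])
    show "(z, ?p z) \<in> orb ?q"
    proof -
      consider "?p z = x" | "?p z = y" | "?p z \<noteq> x" "?p z \<noteq> y" by auto
      then show ?thesis
      proof cases
        case 1
        then show ?thesis using z 2 by (auto simp: w intro: orb_trans)
      next
        case 2
        then show ?thesis using z 1 by (auto simp: w intro: orb_trans)
      next
        case 3
        then show ?thesis using z by (auto simp: w)
      qed
    qed
  qed
  then have "linked (set ws) \<subseteq> orb ?q" using Cons.IH xy by auto
  moreover have "set ws \<union> (set ws)\<inverse> \<subseteq> linked (set ws)" by (auto simp: linked_def)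
  ultimately have "set (w # ws) \<union> (set (w # ws))\<inverse> \<subseteq> orb ?q"
    using 1 2 by (auto simp: w)
  then show ?case by (rule linked_least[OF _ rt])
qed

lemma orb_forest:
  assumes "swap_word n ws" "forest ws"
  shows "orb (swap_prod ws) = linked (set ws)"
  using linked_subset_orb[OF assms] orb_subset_linked by blast

text \<open>Composing with the transposition of \<open>x\<close> and \<open>p x\<close> makes
  \<open>x\<close> a fixed point, so the support shrinks. The support clause keeps \<open>x\<close>
  off the edges of the remaining word, so the new edge attaches \<open>x\<close> as a leaf.\<close>

lemma forest_word_exists:
  assumes "p permutes {1..n}"
  shows "\<exists>ws. swap_word n ws \<and> set ws \<subseteq> {x. p x \<noteq> x} \<times> {x. p x \<noteq> x} \<and> forest ws \<and> swap_prod ws = p"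
  using assms
proof (induction "card {x. p x \<noteq> x}" arbitrary: p rule: less_induct)
  case less
  let ?T = "{x. p x \<noteq> x}"
  show ?case
  proof (cases "p = id")
    case True
    then show ?thesis by (intro exI[of _ "[]"]) auto
  next
    case False
    then obtain x where x: "p x \<noteq> x" by (auto simp: fun_eq_iff)
    define y where "y = p x"
    have T: "?T \<subseteq> {1..n}" using less.prems by (auto simp: permutes_def)
    have inj: "inj p" using less.prems by (rule permutes_inj)
    have px: "p y \<noteq> y" using x injD[OF inj] by (auto simp: y_def)
    have xy: "x \<in> {1..n}" "y \<in> {1..n}" "x \<noteq> y" using T x px by (auto simp: y_def)
    define q where "q = transpose x y \<circ> p"
    have qp: "q permutes {1..n}"
      unfolding q_def using less.prems xy by (intro permutes_compose permutes_swap_id)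
    have sub: "{z. q z \<noteq> z} \<subseteq> ?T - {x}"
      using x px by (auto simp: q_def y_def transpose_def split: if_splits)
    have fin: "finite ?T" using T by (rule finite_subset) simp
    have "card {z. q z \<noteq> z} < card ?T"
      by (rule psubset_card_mono[OF fin]) (use sub x in auto)
    from less.hyps[OF this qp] obtain ws where ws: "swap_word n ws"
      "set ws \<subseteq> {z. q z \<noteq> z} \<times> {z. q z \<noteq> z}" "forest ws" "swap_prod ws = q" by auto
    have "(x, y) \<notin> linked (set ws)"
      using linked_subset_support(1)[OF ws(2), of x y] sub xy(3) by auto
    moreover have "transpose x y \<circ> q = p" by (simp add: q_def fun_eq_iff)
    moreover have "set ws \<subseteq> ?T \<times> ?T" using ws(2) sub by auto
    ultimately show ?thesis
      using ws xy x px by (intro exI[of _ "(x, y) # ws"]) auto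
  qed
qed

text \<open>The components of a forest are the orbits of its product, and any word for that product
  links each orbit. So \<open>vs\<close> has at most as many components and hence at least as many
  letters.\<close>

lemma forest_length_minimal:
  assumes "swap_word n ws" "forest ws" "swap_word n vs" "swap_prod vs = swap_prod ws"
  shows "length ws \<le> length vs"
proof -
  have "linked (set ws) \<subseteq> linked (set vs)"
    using orb_forest[OF assms(1,2)] orb_subset_linked[of vs] assms(4) by simp
  then have "components n (set vs) \<le> components n (set ws)" by (rule components_mono)
  then show ?thesis
    using components_word(1)[OF assms(3)] components_word(2)[OF assms(1)] assms(2) by linarith
qed

lemma swap_length_le:
  assumes "swap_word n ws"
  shows "swap_length n (swap_prod ws) \<le> length ws"
  unfolding swap_length_def by (rule Least_le) (use assms in auto)

lemma swap_length_forest: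
  assumes "swap_word n ws" "forest ws"
  shows "swap_length n (swap_prod ws) = length ws"
  unfolding swap_length_def
  by (rule Least_equality) (use assms forest_length_minimal in auto)

lemma minimal_word_exists:
  assumes "p permutes {1..n}"
  obtains ws where "swap_word n ws" "length ws = swap_length n p" "swap_prod ws = p"
proof -
  have "\<exists>k ws. swap_word n ws \<and> length ws = k \<and> swap_prod ws = p"
    using forest_word_exists[OF assms] by auto
  then have "\<exists>ws. swap_word n ws \<and> length ws = swap_length n p \<and> swap_prod ws = p"
    unfolding swap_length_def by (rule LeastI_ex)
  then show ?thesis using that by auto
qed

text \<open>A forest word with the same product has the same length and at least as many components,
  which forces equality in the component bound for \<open>ws\<close>.\<close>

lemma minimal_word_forest:
  assumes "swap_word n ws" "length ws = swap_length n (swap_prod ws)"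
  shows "forest ws"
proof -
  obtain fs where fs: "swap_word n fs" "forest fs" "swap_prod fs = swap_prod ws"
    using forest_word_exists[OF swap_prod_permutes[OF assms(1)]] by auto
  have len: "length fs = length ws"
    using swap_length_forest[OF fs(1,2)] fs(3) assms(2) by simp
  have "linked (set fs) \<subseteq> linked (set ws)"
    using orb_forest[OF fs(1,2)] orb_subset_linked[of ws] fs(3) by simp
  then have "components n (set ws) \<le> components n (set fs)" by (rule components_mono)
  then show ?thesis
    using components_word[OF assms(1)] components_word(2)[OF fs(1)] fs(2) len by linarith
qed

lemma swap_prod_append: "swap_prod (us @ vs) = swap_prod us \<circ> swap_prod vs"
  by (induction us) (auto simp: o_assoc)

lemma swap_word_append [simp]: "swap_word n (us @ vs) \<longleftrightarrow> swap_word n us \<and> swap_word n vs"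
  by (auto simp: swap_word_def)

lemma swap_word_rev [simp]: "swap_word n (rev us) \<longleftrightarrow> swap_word n us"
  by (auto simp: swap_word_def)

lemma swap_prod_rev: "swap_prod (rev ws) = inv (swap_prod ws)"
proof -
  have "swap_prod (rev ws) \<circ> swap_prod ws = id \<and> swap_prod ws \<circ> swap_prod (rev ws) = id"
  proof (induction ws)
    case (Cons w ws)
    obtain i j where w: "w = (i, j)" by (cases w)
    show ?case using Cons by (auto simp: w swap_prod_append fun_eq_iff)
  qed simp
  then show ?thesis by (metis inv_unique_comp)
qed

text \<open>
  Reversing the word of \<open>c\<close> changes neither the edges nor the length of a word for \<open>c \<circ> d\<close>,
  and both the orbits and the minimality only depend on these.
\<close>

lemma orb_inv_factor:
  assumes "c permutes {1..n}" "d permutes {1..n}"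
    and "swap_length n (c \<circ> d) = swap_length n c + swap_length n d"
  shows "orb (inv c \<circ> d) = orb (c \<circ> d)"
    and "swap_length n (inv c \<circ> d) = swap_length n c + swap_length n d"
proof -
  obtain us where us: "swap_word n us" "length us = swap_length n c" "swap_prod us = c"
    using minimal_word_exists[OF assms(1)] by blast
  obtain vs where vs: "swap_word n vs" "length vs = swap_length n d" "swap_prod vs = d"
    using minimal_word_exists[OF assms(2)] by blast
  have w1: "swap_word n (us @ vs)" and w2: "swap_word n (rev us @ vs)" using us vs by auto
  have f1: "forest (us @ vs)"
    by (rule minimal_word_forest[OF w1]) (use us vs assms(3) in \<open>simp add: swap_prod_append\<close>)
  then have f2: "forest (rev us @ vs)"
    using components_word(2)[OF w1] components_word(2)[OF w2] by simp
  show "orb (inv c \<circ> d) = orb (c \<circ> d)"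
    using orb_forest[OF w1 f1] orb_forest[OF w2 f2] us vs
    by (simp add: swap_prod_append swap_prod_rev)
  show "swap_length n (inv c \<circ> d) = swap_length n c + swap_length n d"
    using swap_length_forest[OF w2 f2] us vs by (simp add: swap_prod_append swap_prod_rev)
qed

section \<open>The word metric\<close>

text \<open>Edges multiply on the right, so each step of a walk appends a letter at the end of the
  word.\<close>

lemma cayley_walk_iff:
  assumes "a permutes {1..n}"
  shows "(a, b) \<in> cayley_edges n ^^ k \<longleftrightarrow>
    (\<exists>ws. swap_word n ws \<and> length ws = k \<and> b = a \<circ> swap_prod ws)"
proof (induction k arbitrary: b)
  case 0
  show ?case by auto
next
  case (Suc k)
  show ?case
  proof
    assume "(a, b) \<in> cayley_edges n ^^ Suc k"
    then obtain b' where b': "(a, b') \<in> cayley_edges n ^^ k" "(b', b) \<in> cayley_edges n" by auto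
    obtain ws where ws: "swap_word n ws" "length ws = k" "b' = a \<circ> swap_prod ws"
      using b'(1) unfolding Suc.IH by blast
    obtain i j where ij: "i \<in> {1..n}" "j \<in> {1..n}" "i \<noteq> j" "b = b' \<circ> transpose i j"
      using b'(2) by (auto simp: cayley_edges_def)
    show "\<exists>ws. swap_word n ws \<and> length ws = Suc k \<and> b = a \<circ> swap_prod ws"
      using ws ij by (intro exI[of _ "ws @ [(i, j)]"]) (auto simp: swap_prod_append)
  next
    assume "\<exists>ws. swap_word n ws \<and> length ws = Suc k \<and> b = a \<circ> swap_prod ws"
    then obtain ws where ws: "swap_word n ws" "length ws = Suc k" "b = a \<circ> swap_prod ws" by auto
    then obtain us i j where us: "ws = us @ [(i, j)]"
      by (cases ws rule: rev_cases) auto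
    let ?b = "a \<circ> swap_prod us"
    have "(a, ?b) \<in> cayley_edges n ^^ k" unfolding Suc.IH using ws us by auto
    moreover have "?b permutes {1..n}"
      using assms ws us by (intro permutes_compose swap_prod_permutes) auto
    then have "(?b, b) \<in> cayley_edges n"
      using ws us by (fastforce simp: cayley_edges_def Sn_def swap_prod_append o_assoc)
    ultimately show "(a, b) \<in> cayley_edges n ^^ Suc k" by auto
  qed
qed

lemma cdist_eq_swap_length:
  assumes "a permutes {1..n}"
  shows "cdist n a b = swap_length n (inv a \<circ> b)"
proof -
  have "b = a \<circ> w \<longleftrightarrow> w = inv a \<circ> b" for w
    using permutes_inverses[OF assms] by (auto simp: fun_eq_iff)
  then show ?thesis
    unfolding cdist_def swap_length_def cayley_walk_iff[OF assms] by metis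
qed

lemma swap_length_inv:
  assumes "p permutes {1..n}"
  shows "swap_length n (inv p) = swap_length n p"
proof -
  have le: "swap_length n (inv q) \<le> swap_length n q" if "q permutes {1..n}" for q
  proof -
    obtain ws where "swap_word n ws" "length ws = swap_length n q" "swap_prod ws = q"
      using minimal_word_exists[OF \<open>q permutes {1..n}\<close>] by blast
    then show ?thesis using swap_length_le[of n "rev ws"] by (simp add: swap_prod_rev)
  qed
  show ?thesis
    using le[OF assms] le[OF permutes_inv[OF assms]] by (simp add: permutes_inv_inv[OF assms])
qed

lemma swap_length_comp_le:
  assumes "p permutes {1..n}" "q permutes {1..n}"
  shows "swap_length n (p \<circ> q) \<le> swap_length n p + swap_length n q"
proof -
  obtain us where "swap_word n us" "length us = swap_length n p" "swap_prod us = p"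
    using minimal_word_exists[OF assms(1)] by blast
  moreover obtain vs where "swap_word n vs" "length vs = swap_length n q" "swap_prod vs = q"
    using minimal_word_exists[OF assms(2)] by blast
  ultimately show ?thesis
    using swap_length_le[of n "us @ vs"] by (simp add: swap_prod_append)
qed

lemma swap_prod_conj:
  assumes "bij s"
  shows "swap_prod (map (map_prod s s) ws) = s \<circ> swap_prod ws \<circ> inv s"
proof (induction ws)
  case Nil
  show ?case using assms by (simp add: fun_eq_iff bij_is_surj surj_f_inv_f)
next
  case (Cons w ws)
  obtain i j where w: "w = (i, j)" by (cases w)
  have "transpose (s i) (s j) (s z) = s (transpose i j z)" for z
    using assms by (simp add: transpose_apply_commute transpose_def bij_is_inj inj_eq)
  then show ?case using Cons by (simp add: w fun_eq_iff)
qed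

text \<open>Relabelling the letters turns a word into an equally long word for the conjugate;
  conjugating back gives the other inequality.\<close>

lemma swap_length_conj:
  assumes "p permutes {1..n}" "s permutes {1..n}"
  shows "swap_length n (s \<circ> p \<circ> inv s) = swap_length n p"
proof -
  have le: "swap_length n (t \<circ> q \<circ> inv t) \<le> swap_length n q"
    if "q permutes {1..n}" "t permutes {1..n}" for q t
  proof -
    obtain ws where ws: "swap_word n ws" "length ws = swap_length n q" "swap_prod ws = q"
      using minimal_word_exists[OF \<open>q permutes {1..n}\<close>] by blast
    have "swap_word n (map (map_prod t t) ws)"
      using ws(1) permutes_in_image[OF that(2)] inj_eq[OF permutes_inj[OF that(2)]]
      by (fastforce simp: swap_word_def simp del: atLeastAtMost_iff)
    then show ?thesis
      using swap_length_le ws swap_prod_conj[OF permutes_bij[OF that(2)]] by fastforce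
  qed
  have "inv s \<circ> (s \<circ> p \<circ> inv s) \<circ> inv (inv s) = p"
    using permutes_inverses[OF assms(2)] by (simp add: fun_eq_iff permutes_inv_inv[OF assms(2)])
  moreover have "(s \<circ> p \<circ> inv s) permutes {1..n}"
    using assms by (intro permutes_compose permutes_inv)
  ultimately show ?thesis
    using le[OF assms] le[of "s \<circ> p \<circ> inv s" "inv s"] permutes_inv[OF assms(2)] by simp
qed

section \<open>Conjugation to block shifts\<close>

fun cycles_prod :: "'a list list \<Rightarrow> 'a \<Rightarrow> 'a" where
  "cycles_prod [] = id"
| "cycles_prod (cs # css) = cycle_of_list cs \<circ> cycles_prod css"

lemma cycles_prod_outside:
  assumes "z \<notin> set (concat css)"
  shows "cycles_prod css z = z"
  using assms by (induction css) (auto simp: id_outside_supp)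

lemma cycles_prod_inside:
  assumes "distinct (concat css)" "cs \<in> set css" "z \<in> set cs"
  shows "cycles_prod css z = cycle_of_list cs z"
  using assms
proof (induction css)
  case (Cons ds css)
  show ?case
  proof (cases "z \<in> set ds")
    case True
    then have "z \<notin> set (concat css)" using Cons.prems by auto
    then have "cs = ds" using Cons.prems by auto
    then show ?thesis using cycles_prod_outside[OF \<open>z \<notin> set (concat css)\<close>] by simp
  next
    case False
    then have cs: "cs \<in> set css" using Cons.prems by auto
    then have "cycles_prod css z = cycle_of_list cs z"
      using Cons by auto
    moreover have "cycle_of_list cs z \<in> set cs"
      using permutes_in_image[OF cycle_permutes] Cons.prems(3) by metis
    then have "cycle_of_list cs z \<notin> set ds" using cs Cons.prems(1) by auto
    ultimately show ?thesis by (simp add: id_outside_supp)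
  qed
qed simp

text \<open>Conjugating a cycle relabels its entries. The second assumption says that
  \<open>s\<close> writes the entries of \<open>css\<close> in order along \<open>t + 1\<close>,
  \<open>t + 2\<close> and so on, so each block goes to the cycle in the same position.\<close>

lemma block_shift_conj:
  assumes "bij s" "map s [t + 1..<t + length (concat css) + 1] = concat css"
  shows "s \<circ> block_shift t (map length css) \<circ> inv s = cycles_prod css"
  using assms(2)
proof (induction css arbitrary: t)
  case Nil
  show ?case using assms(1) by (simp add: fun_eq_iff bij_is_surj surj_f_inv_f)
next
  case (Cons cs css)
  let ?k = "length cs" and ?m = "length (concat css)"
  have "[t + 1..<t + length (concat (cs # css)) + 1] =
      [t + 1..<t + ?k + 1] @ [t + ?k + 1..<t + ?k + ?m + 1]"
    using upt_add_eq_append[of "t + 1" "t + ?k + 1" ?m] by (simp add: ac_simps del: upt_Suc)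
  then have *: "map s [t + 1..<t + ?k + 1] = cs"
    "map s [t + ?k + 1..<t + ?k + ?m + 1] = concat css"
    using Cons.prems by (simp_all del: upt_Suc)
  have "s \<circ> block_shift t (map length (cs # css)) \<circ> inv s =
      (s \<circ> cycle_of_list [t + 1..<t + ?k + 1] \<circ> inv s) \<circ>
      (s \<circ> block_shift (t + ?k) (map length css) \<circ> inv s)"
    using assms(1) by (simp add: fun_eq_iff bij_is_inj)
  also have "s \<circ> cycle_of_list [t + 1..<t + ?k + 1] \<circ> inv s = cycle_of_list cs"
    using conjugation_of_cycle[OF distinct_upt assms(1)] * by metis
  also have "s \<circ> block_shift (t + ?k) (map length css) \<circ> inv s =
      cycles_prod css"
    using Cons.IH * by blast
  finally show ?case by simp
qed

lemma orb_support:
  assumes "permutation p"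
  shows "orb p `` {a} = set (support p a)"
  unfolding support_set[OF assms] by (auto simp: orb_def)

text \<open>The enumeration \<open>Bs\<close> of the orbits is a parameter, so that two permutations
  with equal orbits obtain literally the same composition.\<close>

lemma conj_block_shift_of_orbits:
  assumes p: "p permutes {1..n}" and Bs: "distinct Bs" "set Bs = {1..n} // orb p"
  shows "is_composition n (map card Bs) \<and>
    (\<exists>s. s permutes {1..n} \<and> p = s \<circ> comp_perm (map card Bs) \<circ> inv s)"
proof -
  have perm: "permutation p" using p by (auto simp: permutation_permutes)
  have "\<forall>B\<in>set Bs. \<exists>a. a \<in> {1..n} \<and> B = set (support p a)"
    unfolding Bs(2) quotient_def by (auto simp: orb_support[OF perm] simp del: set_map)
  then obtain r where r: "\<And>B. B \<in> set Bs \<Longrightarrow> r B \<in> {1..n} \<and> B = set (support p (r B))"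
    by metis
  \<comment> \<open>Each orbit is written out as the cycle of \<open>p\<close> through its
    representative, in the order of \<open>Bs\<close>.\<close>
  define css where "css = map (\<lambda>B. support p (r B)) Bs"
  have cyc: "distinct cs" "\<And>z. z \<in> set cs \<Longrightarrow> p z = cycle_of_list cs z" if "cs \<in> set css" for cs
    using that cycle_of_permutation[OF perm] cycle_restrict[OF perm] unfolding css_def by auto
  have sets: "map set css = Bs"
    unfolding css_def map_map by (rule map_idI) (use r in auto)
  have lens: "map length css = map card Bs"
    unfolding sets[symmetric] map_map using cyc(1) by (simp add: distinct_card)
  have ne: "B \<noteq> {}" if "B \<in> set Bs" for B
    using that unfolding Bs(2) quotient_def by (auto intro: orb_refl)
  have un: "\<Union> (set Bs) = {1..n}"
  proof
    have "orb p `` {x} \<subseteq> {1..n}" if "x \<in> {1..n}" for x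
      using permutes_in_image[OF permutes_funpow[OF p]] that by (auto simp: orb_def)
    then show "\<Union> (set Bs) \<subseteq> {1..n}" unfolding Bs(2) quotient_def by blast
    show "{1..n} \<subseteq> \<Union> (set Bs)" 
    proof
      fix x assume "x \<in> {1..n}"
      then have "orb p `` {x} \<in> set Bs" unfolding Bs(2) by (rule quotientI)
      moreover have "x \<in> orb p `` {x}" using orb_refl by simp
      ultimately show "x \<in> \<Union> (set Bs)" by blast
    qed
  qed
  have set_concat: "set (concat css) = {1..n}"
    using un unfolding sets[symmetric] by simp
  have disj: "B \<inter> B' = {}" if "B \<in> set Bs" "B' \<in> set Bs" "B \<noteq> B'" for B B'
  proof (rule disjointD[OF disjoint_support[OF perm] _ _ that(3)])
    show "B \<in> range (\<lambda>a. set (support p a))" "B' \<in> range (\<lambda>a. set (support p a))"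
      using r[OF that(1)] r[OF that(2)] by blast+
  qed
  have dist: "distinct (concat css)"
  proof (rule distinct_concat)
    show "distinct css" using Bs(1) unfolding sets[symmetric] by (simp add: distinct_map)
    show "distinct ys" if "ys \<in> set css" for ys using cyc that by blast
    show "set ys \<inter> set zs = {}" if "ys \<in> set css" "zs \<in> set css" "ys \<noteq> zs" for ys zs
    proof -
      have "inj_on set (set css)" using Bs(1) unfolding sets[symmetric] by (simp add: distinct_map)
      then have "set ys \<noteq> set zs" using that by (auto dest: inj_onD)
      moreover have "set ys \<in> set Bs" "set zs \<in> set Bs"
        using that unfolding sets[symmetric] by auto
      ultimately show ?thesis using disj by blast
    qed
  qed
  have len: "length (concat css) = n"
    using distinct_card[OF dist] set_concat by simp
  have comp: "is_composition n (map card Bs)"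
  proof -
    have "0 < card B" if "B \<in> set Bs" for B
      using ne[OF that] un that by (metis Union_upper card_gt_0_iff finite_atLeastAtMost finite_subset)
    moreover have "sum_list (map card Bs) = n"
      using len unfolding lens[symmetric] by (simp add: length_concat)
    ultimately show ?thesis by (auto simp: is_composition_def)
  qed
  \<comment> \<open>The points start at 1 and list positions at 0, hence \<open>i - 1\<close>; the
    identity outside makes \<open>s\<close> a permutation of \<open>{1..n}\<close>.\<close>
  define s where "s i = (if i \<in> {1..n} then concat css ! (i - 1) else i)" for i
  have map_s: "map s [0 + 1..<0 + length (concat css) + 1] = concat css"
    by (rule nth_equalityI) (auto simp: len s_def simp del: upt_Suc)
  have "bij_betw s {1..n} {1..n}"
  proof -
    have up: "set [0 + 1..<0 + length (concat css) + 1] = {1..n}" by (auto simp: len)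
    have "s ` {1..n} = {1..n}" using map_s set_concat up by (metis set_map)
    moreover have "inj_on s {1..n}" using map_s dist up by (metis distinct_map)
    ultimately show ?thesis by (simp add: bij_betw_def)
  qed
  then have s: "s permutes {1..n}" by (rule bij_imp_permutes) (auto simp: s_def)
  have "s \<circ> comp_perm (map card Bs) \<circ> inv s = cycles_prod css"
    unfolding comp_perm_def lens[symmetric]
    using block_shift_conj[OF permutes_bij[OF s] map_s] .
  also have "\<dots> = p"
  proof
    fix z
    show "cycles_prod css z = p z"
    proof (cases "z \<in> {1..n}")
      case True
      then obtain cs where "cs \<in> set css" "z \<in> set cs"
        unfolding set_concat[symmetric] by auto
      then show ?thesis using cycles_prod_inside[OF dist] cyc(2) by simp
    next
      case False
      then show ?thesis
        using cycles_prod_outside[of z css] permutes_not_in[OF p False] unfolding set_concat by metis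
    qed
  qed
  finally show ?thesis using s comp by auto
qed

lemma conj_block_shift:
  assumes "p permutes {1..n}" "q permutes {1..n}" "orb p = orb q"
  obtains mu s t where "is_composition n mu" "s permutes {1..n}" "t permutes {1..n}"
    "p = s \<circ> comp_perm mu \<circ> inv s" "q = t \<circ> comp_perm mu \<circ> inv t"
proof -
  have "finite ({1..n} // orb p)" by (simp add: quotient_def)
  then obtain Bs where "set Bs = {1..n} // orb p" "distinct Bs"
    using finite_distinct_list by blast
  then show ?thesis
    using that conj_block_shift_of_orbits[OF assms(1)] conj_block_shift_of_orbits[OF assms(2)]
      assms(3) by metis
qed

text \<open>Positive parts whose sum is at most their number are all equal to 1, and one-element
  cycles are trivial. This handles the compositions that the concentration hypothesis
  excludes.\<close>

lemma block_shift_trivial: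
  assumes "\<forall>k\<in>set mu. 0 < k" "sum_list mu \<le> length mu"
  shows "block_shift t mu = id"
  using assms
proof (induction mu arbitrary: t)
  case (Cons k mu)
  have "length mu \<le> sum_list mu"
    using Cons.prems(1) by (induction mu) auto
  then have "k = 1" "sum_list mu \<le> length mu" using Cons.prems by auto
  then show ?case using Cons by auto
qed simp

section \<open>Midpoints\<close>

text \<open>Extends \<open>Cr\<close> from block shifts to arbitrary permutations, since
  \<open>inv a \<circ> b\<close> is only conjugate to a block shift.\<close>

definition mids :: "nat \<Rightarrow> (nat \<Rightarrow> nat) \<Rightarrow> (nat \<Rightarrow> nat) set" where
  "mids n p = {c. is_midpoint n id p c}"

lemma Cr_eq_mids: "Cr n mu = mids n (comp_perm mu)"
  by (simp add: Cr_def mids_def)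

lemma mids_iff:
  "c \<in> mids n p \<longleftrightarrow> c permutes {1..n} \<and>
     swap_length n c + swap_length n (inv c \<circ> p) = swap_length n p \<and>
     int (swap_length n c) - int (swap_length n (inv c \<circ> p)) \<in> {-1, 0, 1}"
  by (auto simp: mids_def is_midpoint_def Sn_def cdist_eq_swap_length permutes_id)

lemma finite_mids: "finite (mids n p)"
  by (rule finite_subset[OF _ finite_permutations[of "{1..n}"]]) (auto simp: mids_iff)

lemma permutes_conj:
  assumes "s permutes S" "p permutes S"
  shows "(s \<circ> p \<circ> inv s) permutes S" "(inv s \<circ> p \<circ> s) permutes S"
  using assms by (auto intro: permutes_compose permutes_inv)

text \<open>Cut a minimal word in the middle. Subadditivity forces both halves to be minimal, and
  their lengths differ by at most one.\<close>

lemma mids_nonempty: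
  assumes "p permutes {1..n}"
  shows "mids n p \<noteq> {}"
proof -
  obtain ws where ws: "swap_word n ws" "length ws = swap_length n p" "swap_prod ws = p"
    using minimal_word_exists[OF assms] by blast
  define k where "k = length ws div 2"
  define c d where "c = swap_prod (take k ws)" and "d = swap_prod (drop k ws)"
  have w: "swap_word n (take k ws)" "swap_word n (drop k ws)"
    using ws(1) set_take_subset set_drop_subset unfolding swap_word_def by fast+
  have perm: "c permutes {1..n}" "d permutes {1..n}"
    unfolding c_def d_def using w swap_prod_permutes by auto
  have p: "p = c \<circ> d"
    unfolding c_def d_def swap_prod_append[symmetric] using ws by simp
  have "inv c \<circ> p = d"
    unfolding p using permutes_inverses[OF perm(1)] by (simp add: fun_eq_iff)
  moreover have "swap_length n c \<le> k" "swap_length n d \<le> length ws - k"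
    using swap_length_le[OF w(1)] swap_length_le[OF w(2)] by (auto simp: c_def d_def)
  moreover have "swap_length n p \<le> swap_length n c + swap_length n d"
    unfolding p by (rule swap_length_comp_le[OF perm])
  ultimately have "c \<in> mids n p"
    unfolding mids_iff using perm ws(2) k_def by auto
  then show ?thesis by auto
qed

lemma mids_conj:
  assumes "p permutes {1..n}" "s permutes {1..n}" "c \<in> mids n p"
  shows "s \<circ> c \<circ> inv s \<in> mids n (s \<circ> p \<circ> inv s)"
proof -
  have c: "c permutes {1..n}" using assms(3) by (simp add: mids_iff)
  have "inv (s \<circ> c \<circ> inv s) = s \<circ> inv c \<circ> inv s"
    using permutes_bij[OF c] permutes_bij[OF assms(2)]
    by (simp add: o_inv_distrib bij_comp bij_imp_bij_inv inv_inv_eq o_assoc)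
  then have "inv (s \<circ> c \<circ> inv s) \<circ> (s \<circ> p \<circ> inv s) = s \<circ> (inv c \<circ> p) \<circ> inv s"
    using permutes_inverses[OF assms(2)] by (simp add: fun_eq_iff)
  moreover have "(inv c \<circ> p) permutes {1..n}"
    using assms(1) c by (intro permutes_compose permutes_inv)
  ultimately show ?thesis
    using assms c by (simp add: mids_iff swap_length_conj permutes_conj)
qed

lemma conj_cancel:
  assumes "s permutes S"
  shows "inv s \<circ> (s \<circ> c \<circ> inv s) \<circ> s = c" "s \<circ> (inv s \<circ> c \<circ> s) \<circ> inv s = c"
  using permutes_inverses[OF assms] by (auto simp: fun_eq_iff)

lemma mids_conj_inv:
  assumes "p permutes {1..n}" "s permutes {1..n}" "c \<in> mids n (s \<circ> p \<circ> inv s)"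
  shows "inv s \<circ> c \<circ> s \<in> mids n p"
  using mids_conj[OF permutes_conj(1)[OF assms(2,1)] permutes_inv[OF assms(2)] assms(3)]
  by (simp add: permutes_inv_inv[OF assms(2)] conj_cancel[OF assms(2)])

lemma card_mids_conj:
  assumes "p permutes {1..n}" "s permutes {1..n}"
  shows "card (mids n (s \<circ> p \<circ> inv s)) = card (mids n p)"
proof -
  have "bij_betw (\<lambda>c. inv s \<circ> c \<circ> s) (mids n (s \<circ> p \<circ> inv s)) (mids n p)"
    by (rule bij_betw_byWitness[where f' = "\<lambda>c. s \<circ> c \<circ> inv s"])
      (use conj_cancel[OF assms(2)] mids_conj[OF assms] mids_conj_inv[OF assms] in auto)
  then show ?thesis by (rule bij_betw_same_card)
qed

lemma comp_perm_permutes: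
  assumes "s permutes {1..n}" "p permutes {1..n}" "p = s \<circ> comp_perm mu \<circ> inv s"
  shows "comp_perm mu permutes {1..n}"
  using permutes_conj(2)[OF assms(1,2)] unfolding assms(3) conj_cancel[OF assms(1)] .

text \<open>Equal orbits make both permutations conjugate to one block shift, and conjugation
  carries midpoints to midpoints.\<close>

lemma card_mids_orb:
  assumes "p permutes {1..n}" "q permutes {1..n}" "orb p = orb q"
  shows "card (mids n p) = card (mids n q)"
proof -
  obtain mu s t where mu: "is_composition n mu" "s permutes {1..n}" "t permutes {1..n}"
    "p = s \<circ> comp_perm mu \<circ> inv s" "q = t \<circ> comp_perm mu \<circ> inv t"
    using conj_block_shift[OF assms] by blast
  have "comp_perm mu permutes {1..n}" using comp_perm_permutes mu assms(1) by blast
  then show ?thesis using card_mids_conj mu by metis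
qed

text \<open>With \<open>d = inv c \<circ> p\<close>, the factors \<open>inv c\<close> and
  \<open>d\<close> of \<open>q\<close> have the lengths of \<open>c\<close> and \<open>d\<close>,
  and these still add up to the length of \<open>q\<close>. The midpoint counts agree because
  \<open>q\<close> and \<open>p\<close> have the same orbits.\<close>

lemma mids_flip:
  assumes "p permutes {1..n}" "c \<in> mids n p"
  defines "q \<equiv> inv c \<circ> (inv c \<circ> p)"
  shows "q permutes {1..n}" "inv c \<in> mids n q" "card (mids n q) = card (mids n p)"
proof -
  have c: "c permutes {1..n}" using assms(2) by (simp add: mids_iff)
  let ?d = "inv c \<circ> p"
  have d: "?d permutes {1..n}" using assms(1) c by (intro permutes_compose permutes_inv)
  show q: "q permutes {1..n}"
    unfolding q_def using d c by (intro permutes_compose[OF d] permutes_inv)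
  have cd: "c \<circ> ?d = p" using permutes_inverses[OF c] by (simp add: fun_eq_iff)
  have len: "swap_length n (c \<circ> ?d) = swap_length n c + swap_length n ?d"
    unfolding cd using assms(2) by (simp add: mids_iff)
  have "inv (inv c) \<circ> q = ?d"
    unfolding q_def permutes_inv_inv[OF c] using permutes_inverses[OF c] by (simp add: fun_eq_iff)
  then show "inv c \<in> mids n q"
    using assms(2) orb_inv_factor(2)[OF c d len] permutes_inv[OF c]
    by (simp add: mids_iff swap_length_inv[OF c] q_def)
  show "card (mids n q) = card (mids n p)"
    using orb_inv_factor(1)[OF c d len] card_mids_orb[OF q assms(1)] cd by (simp add: q_def)
qed

lemma mids_translate:
  assumes "a permutes {1..n}" "b permutes {1..n}" "c \<in> mids n (inv a \<circ> b)"
  shows "is_midpoint n a b (a \<circ> c)" "is_midpoint n a b (a \<circ> (inv c \<circ> (inv a \<circ> b)))"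
proof -
  let ?p = "inv a \<circ> b"
  let ?d = "inv c \<circ> ?p"
  have c: "c permutes {1..n}" using assms(3) by (simp add: mids_iff)
  have p: "?p permutes {1..n}" using assms by (intro permutes_compose permutes_inv)
  have d: "?d permutes {1..n}" using p c by (intro permutes_compose[OF p] permutes_inv)
  have ac: "(a \<circ> c) permutes {1..n}" and ad: "(a \<circ> ?d) permutes {1..n}"
    using assms(1) permutes_compose[OF c assms(1)] permutes_compose[OF d assms(1)] by auto
  have bij: "bij a" "bij b" "bij c" "bij ?d" using assms c d permutes_bij by blast+
  have "inv a \<circ> (a \<circ> c) = c" "inv a \<circ> (a \<circ> ?d) = ?d"
    using permutes_inverses[OF assms(1)] by (simp_all add: fun_eq_iff)
  moreover have "inv (a \<circ> c) \<circ> b = ?d" using bij by (simp add: o_inv_distrib o_assoc)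
  \<comment> \<open>The quotient left after \<open>d\<close> is a conjugate of \<open>c\<close>, so
    it has the length of \<open>c\<close>; the two halves of the geodesic swap lengths.\<close>
  moreover have "inv (a \<circ> ?d) \<circ> b = inv ?p \<circ> c \<circ> inv (inv ?p)"
  proof -
    have "inv ?d = inv ?p \<circ> c"
      using o_inv_distrib[of "inv c" ?p] bij permutes_bij[OF p]
      by (simp add: inv_inv_eq bij_imp_bij_inv)
    moreover have "inv (a \<circ> ?d) \<circ> b = inv ?d \<circ> ?p"
      using o_inv_distrib[OF bij(1) bij(4)] by (simp add: o_assoc)
    ultimately show ?thesis using permutes_inv_inv[OF p] by simp
  qed
  ultimately show "is_midpoint n a b (a \<circ> c)" "is_midpoint n a b (a \<circ> ?d)"
    using assms(3) ac ad swap_length_conj[OF c permutes_inv[OF p]]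
    by (auto simp: is_midpoint_def Sn_def cdist_eq_swap_length[OF assms(1)]
        cdist_eq_swap_length[OF ac] cdist_eq_swap_length[OF ad] mids_iff)
qed

section \<open>The counting argument\<close>

lemma cset_dist_eq: "cset_dist n X Y = Min ((\<lambda>(x, y). cdist n x y) ` (X \<times> Y))"
  unfolding cset_dist_def by (rule arg_cong[of _ _ Min]) auto

lemma cset_dist_le:
  assumes "finite X" "finite Y" "x \<in> X" "y \<in> Y"
  shows "cset_dist n X Y \<le> cdist n x y"
  unfolding cset_dist_eq by (rule Min_le) (use assms in auto)

lemma cset_dist_ge:
  assumes "finite X" "finite Y" "X \<noteq> {}" "Y \<noteq> {}"
    and "\<And>x y. x \<in> X \<Longrightarrow> y \<in> Y \<Longrightarrow> r \<le> cdist n x y"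
  shows "r \<le> cset_dist n X Y"
  unfolding cset_dist_eq by (rule Min.boundedI) (use assms in auto)

lemma finite_Sn: "finite (Sn n)"
  by (simp add: Sn_def finite_permutations)

lemma swap_length_id [simp]: "swap_length n id = 0"
  using swap_length_le[of n "[]"] by simp

lemma swap_length_eq_0:
  assumes "p permutes {1..n}" "swap_length n p = 0"
  shows "p = id"
  using minimal_word_exists[OF assms(1)] assms(2) by (metis length_0_conv swap_prod.simps(1))

text \<open>The concentration hypothesis is transported from block shifts to an arbitrary
  \<open>q\<close> by conjugation, and its exponent is weakened to one that is independent of the
  cycle type.\<close>

lemma crossover_bound:
  fixes n :: nat and \<epsilon> :: real and A B :: "(nat \<Rightarrow> nat) set"
  assumes "n \<ge> 2" "\<epsilon> > 0"
    and concentration: "\<And>mu C (r::real).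
           is_composition n mu \<Longrightarrow> length mu < n \<Longrightarrow>
           C \<subseteq> Cr n mu \<Longrightarrow> C \<noteq> {} \<Longrightarrow> r \<ge> 0 \<Longrightarrow>
           real (cset_dist n C (dual mu ` C)) \<ge> r \<Longrightarrow>
           real (card C) / real (card (Cr n mu))
             \<le> exp (- (\<epsilon> * r\<^sup>2 / (real n - real (length mu))))"
    and AB: "A \<subseteq> Sn n" "B \<subseteq> Sn n"
    and m: "m permutes {1..n}" and q: "q permutes {1..n}"
  shows "real (card {c \<in> mids n q. m \<circ> c \<in> A \<and> m \<circ> (inv c \<circ> q) \<in> B}) / real (card (mids n q))
    \<le> exp (- (\<epsilon> * (real (cset_dist n A B))\<^sup>2 / (real n - 1)))"
proof -
  define C where "C = {c \<in> mids n q. m \<circ> c \<in> A \<and> m \<circ> (inv c \<circ> q) \<in> B}"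
  define r where "r = cset_dist n A B"
  have fin: "finite A" "finite B" "finite C"
    using finite_subset[OF AB(1) finite_Sn] finite_subset[OF AB(2) finite_Sn]
    by (simp_all add: C_def finite_mids)
  have Cp: "c permutes {1..n}" if "c \<in> C" for c
    using that by (simp add: C_def mids_iff)
  \<comment> \<open>Left translation by \<open>m\<close> turns the distance from \<open>c\<close> to
    the dual of \<open>c'\<close> into a distance between a point of \<open>A\<close> and a point of
    \<open>B\<close>.\<close>
  have dist: "r \<le> swap_length n (inv c \<circ> (inv c' \<circ> q))" if "c \<in> C" "c' \<in> C" for c c'
  proof -
    have mc: "(m \<circ> c) permutes {1..n}" using Cp[OF that(1)] m by (rule permutes_compose)
    have "inv (m \<circ> c) \<circ> (m \<circ> (inv c' \<circ> q)) = inv c \<circ> (inv c' \<circ> q)"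
      using permutes_bij[OF m] permutes_bij[OF Cp[OF that(1)]] permutes_inverses[OF m]
      by (simp add: o_inv_distrib fun_eq_iff)
    moreover have "r \<le> cdist n (m \<circ> c) (m \<circ> (inv c' \<circ> q))"
      unfolding r_def using that fin by (intro cset_dist_le) (auto simp: C_def)
    ultimately show ?thesis by (simp add: cdist_eq_swap_length[OF mc])
  qed
  have "real (card C) / real (card (mids n q)) \<le> exp (- (\<epsilon> * (real r)\<^sup>2 / (real n - 1)))"
  \<comment> \<open>An empty \<open>C\<close> makes the left side 0, and \<open>r = 0\<close> makes
    the right side 1.\<close>
  proof (cases "C = {} \<or> r = 0")
    case True
    have "card C \<le> card (mids n q)" by (rule card_mono) (auto simp: finite_mids C_def)
    then have "real (card C) / real (card (mids n q)) \<le> 1" by (auto simp: divide_le_eq_1)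
    then show ?thesis using True by auto
  next
    case False
    then have C: "C \<noteq> {}" and r: "r > 0" by auto
    \<comment> \<open>For \<open>q = id\<close> the only midpoint is \<open>id\<close>, which equals
      its own dual, contradicting \<open>r > 0\<close>. This later yields
      \<open>length mu < n\<close>.\<close>
    have "q \<noteq> id"
    proof
      assume id: "q = id"
      obtain c where c: "c \<in> C" using C by auto
      then have "c = id"
        using swap_length_eq_0[OF Cp[OF c]] by (auto simp: C_def mids_iff id)
      then show False using dist[OF c c] r by (simp add: id)
    qed
    obtain mu s where mu: "is_composition n mu" "s permutes {1..n}"
      "q = s \<circ> comp_perm mu \<circ> inv s"
      using conj_block_shift[OF q q] by blast
    have cp: "comp_perm mu permutes {1..n}" by (rule comp_perm_permutes[OF mu(2) q mu(3)])
    have len: "length mu < n"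
    proof (rule ccontr)
      assume "\<not> length mu < n"
      then have "comp_perm mu = id"
        unfolding comp_perm_def using mu(1)
        by (intro block_shift_trivial) (auto simp: is_composition_def)
      then have "q = id" using mu(3) permutes_inverses[OF mu(2)] by (simp add: fun_eq_iff)
      then show False using \<open>q \<noteq> id\<close> by simp
    qed
    have "mu \<noteq> []" using mu(1) assms(1) by (auto simp: is_composition_def)
    then have len1: "1 \<le> length mu" by (cases mu) auto
    define D where "D = (\<lambda>c. inv s \<circ> c \<circ> s) ` C"
    have D: "D \<subseteq> Cr n mu"
      using mids_conj_inv[OF cp mu(2)] unfolding D_def Cr_eq_mids C_def mu(3) by auto
    have "inj_on (\<lambda>c. inv s \<circ> c \<circ> s) C"
      by (rule inj_on_inverseI[where g = "\<lambda>c. s \<circ> c \<circ> inv s"]) (rule conj_cancel[OF mu(2)])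
    then have cardD: "card D = card C" unfolding D_def by (rule card_image)
    have cardCr: "card (Cr n mu) = card (mids n q)"
      unfolding Cr_eq_mids mu(3) using card_mids_conj[OF cp mu(2)] by simp
    have "r \<le> cset_dist n D (dual mu ` D)"
    proof (rule cset_dist_ge)
      fix x y assume "x \<in> D" "y \<in> dual mu ` D"
      then obtain c c' where c: "c \<in> C" "x = inv s \<circ> c \<circ> s"
        and c': "c' \<in> C" "y = dual mu (inv s \<circ> c' \<circ> s)"
        unfolding D_def by auto
      have x: "x permutes {1..n}" unfolding c(2) using permutes_conj(2)[OF mu(2) Cp[OF c(1)]] .
      have inv_conj: "inv (inv s \<circ> e \<circ> s) = inv s \<circ> inv e \<circ> s" if "e permutes {1..n}" for e
        using permutes_bij[OF that] permutes_bij[OF mu(2)]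
        by (simp add: o_inv_distrib bij_comp bij_imp_bij_inv inv_inv_eq o_assoc)
      have "y = inv s \<circ> inv c' \<circ> q \<circ> s"
        unfolding c'(2) dual_def inv_conj[OF Cp[OF c'(1)]] mu(3)
        using permutes_inverses[OF mu(2)] by (simp add: fun_eq_iff)
      then have "inv x \<circ> y = inv s \<circ> (inv c \<circ> (inv c' \<circ> q)) \<circ> inv (inv s)"
        unfolding c(2) inv_conj[OF Cp[OF c(1)]] permutes_inv_inv[OF mu(2)]
        using permutes_inverses[OF mu(2)] by (simp add: fun_eq_iff)
      moreover have "(inv c \<circ> (inv c' \<circ> q)) permutes {1..n}"
        using q Cp[OF c(1)] Cp[OF c'(1)] by (meson permutes_compose permutes_inv)
      ultimately have "cdist n x y = swap_length n (inv c \<circ> (inv c' \<circ> q))"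
        using swap_length_conj permutes_inv[OF mu(2)] cdist_eq_swap_length[OF x] by metis
      then show "r \<le> cdist n x y" using dist[OF c(1) c'(1)] by simp
    qed (use C fin in \<open>auto simp: D_def\<close>)
    moreover have "D \<noteq> {}" using C by (simp add: D_def)
    ultimately have "real (card C) / real (card (mids n q))
        \<le> exp (- (\<epsilon> * (real r)\<^sup>2 / (real n - real (length mu))))"
      using concentration[OF mu(1) len D, of "real r"] by (simp add: cardD cardCr)
    \<comment> \<open>A composition of \<open>n > 0\<close> has at least one part, so the
      denominator grows to at most \<open>n - 1\<close>.\<close>
    also have "\<dots> \<le> exp (- (\<epsilon> * (real r)\<^sup>2 / (real n - 1)))"
      using len len1 assms(2) by (simp add: frac_le)
    finally show ?thesis .
  qed
  then show ?thesis by (simp add: C_def r_def)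
qed

section \<open>Weighted double counting of the triples\<close>

lemma sum_fst_Sigma:
  fixes g :: "'a \<Rightarrow> real"
  assumes "finite X" "\<forall>x\<in>X. finite (Y x)"
  shows "(\<Sum>z\<in>Sigma X Y. g (fst z)) = (\<Sum>x\<in>X. real (card (Y x)) * g x)"
  using sum.Sigma[OF assms, of "\<lambda>x _. g x"] by (simp add: split_def)

theorem theorem4p5:
  fixes n :: nat and \<epsilon> K :: real and A B :: "(nat \<Rightarrow> nat) set"
  assumes "n \<ge> 2"
    and "\<epsilon> > 0"
    and "\<And>mu C (r::real).
           is_composition n mu \<Longrightarrow> length mu < n \<Longrightarrow>
           C \<subseteq> Cr n mu \<Longrightarrow> C \<noteq> {} \<Longrightarrow> r \<ge> 0 \<Longrightarrow>
           real (cset_dist n C (dual mu ` C)) \<ge> r \<Longrightarrow>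
           real (card C) / real (card (Cr n mu))
             \<le> exp (- (\<epsilon> * r\<^sup>2 / (real n - real (length mu))))"
    and "K = 4 * \<epsilon> / (real n - 1)"
    and "A \<subseteq> Sn n" and "A \<noteq> {}"
    and "B \<subseteq> Sn n" and "B \<noteq> {}"
  shows "ln (real (card (midpoint_set n A B)))
           \<ge> 1/2 * ln (real (card A)) + 1/2 * ln (real (card B))
               + K / 8 * (real (cset_dist n A B))\<^sup>2"
proof -
  define M where "M = midpoint_set n A B"
  define \<delta> where "\<delta> = exp (- (\<epsilon> * (real (cset_dist n A B))\<^sup>2 / (real n - 1)))"
  define C where "C m m' = {c \<in> mids n (inv m \<circ> m'). m \<circ> c \<in> A \<and> m \<circ> (inv c \<circ> (inv m \<circ> m')) \<in> B}"
    for m m'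
  \<comment> \<open>With this weight the midpoints over each pair in \<open>A \<times> B\<close>
    contribute 1 in total.\<close>
  define w where "w p = 1 / real (card (mids n p))" for p
  define T where "T = (SIGMA (a, b) : A \<times> B. mids n (inv a \<circ> b))"
  define U where "U = (SIGMA (m, m') : M \<times> M. C m m')"
  \<comment> \<open>One formula serves both directions: applied to a pair of midpoints and
    \<open>inv c\<close>, it returns the original end points. So \<open>f\<close> is its own left
    inverse on \<open>T\<close>.\<close>
  define f :: "((nat \<Rightarrow> nat) \<times> (nat \<Rightarrow> nat)) \<times> (nat \<Rightarrow> nat) \<Rightarrow>
      ((nat \<Rightarrow> nat) \<times> (nat \<Rightarrow> nat)) \<times> (nat \<Rightarrow> nat)"
    where "f = (\<lambda>((a, b), c). ((a \<circ> c, a \<circ> (inv c \<circ> (inv a \<circ> b))), inv c))"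
  have perm: "a permutes {1..n}" if "a \<in> A \<union> B \<union> M" for a
    using that assms(5,7) by (auto simp: M_def midpoint_set_def is_midpoint_def Sn_def)
  have fin: "finite A" "finite B" "finite M"
    by (rule finite_subset[OF _ finite_Sn[of n]], use perm in \<open>auto simp: Sn_def\<close>)+
  have f_props: "f x \<in> U \<and> w (inv (fst (fst (f x))) \<circ> snd (fst (f x))) = w (inv (fst (fst x)) \<circ> snd (fst x))
      \<and> f (f x) = x"
    if xT: "x \<in> T" for x
  proof -
    obtain a b c where x: "x = ((a, b), c)" and ab: "a \<in> A" "b \<in> B" and c: "c \<in> mids n (inv a \<circ> b)"
      using xT by (auto simp: T_def)
    have a: "a permutes {1..n}" and b: "b permutes {1..n}" using perm ab by auto
    have cp: "c permutes {1..n}" using c by (simp add: mids_iff)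
    have p: "(inv a \<circ> b) permutes {1..n}" using a b by (intro permutes_compose permutes_inv)
    let ?m = "a \<circ> c" and ?m' = "a \<circ> (inv c \<circ> (inv a \<circ> b))"
    have M: "?m \<in> M" "?m' \<in> M"
      using mids_translate[OF a b c] ab by (auto simp: M_def midpoint_set_def)
    have q: "inv ?m \<circ> ?m' = inv c \<circ> (inv c \<circ> (inv a \<circ> b))"
      using permutes_bij[OF a] permutes_bij[OF cp] permutes_inverses[OF a]
      by (simp add: o_inv_distrib fun_eq_iff)
    have undo_f: "?m \<circ> inv c = a" "?m \<circ> (inv (inv c) \<circ> (inv ?m \<circ> ?m')) = b"
      unfolding q permutes_inv_inv[OF cp]
      using permutes_inverses[OF a] permutes_inverses[OF cp] by (simp_all add: fun_eq_iff)
    have "inv c \<in> C ?m ?m'"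
      unfolding C_def using mids_flip(2)[OF p c] undo_f ab by (simp add: q)
    then show ?thesis
      using M mids_flip(3)[OF p c] undo_f permutes_inv_inv[OF cp]
      by (simp add: x f_def U_def w_def q)
  qed
  have inj: "inj_on f T"
    by (rule inj_on_inverseI[of _ f]) (use f_props in blast)
  have finU: "finite U"
    unfolding U_def using fin by (intro finite_SigmaI) (auto simp: C_def finite_mids)
  have "real (card A) * real (card B) = (\<Sum>(a, b)\<in>A \<times> B. 1)"
    by (simp add: card_cartesian_product)
  also have "\<dots> = (\<Sum>(a, b)\<in>A \<times> B. \<Sum>c\<in>mids n (inv a \<circ> b). w (inv a \<circ> b))"
  proof (intro sum.cong refl, clarify)
    fix a b assume "a \<in> A" "b \<in> B"
    then have "(inv a \<circ> b) permutes {1..n}" using perm by (intro permutes_compose permutes_inv) auto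
    then show "1 = (\<Sum>c\<in>mids n (inv a \<circ> b). w (inv a \<circ> b))"
      using mids_nonempty finite_mids by (simp add: w_def card_gt_0_iff)
  qed
  also have "\<dots> = (\<Sum>x\<in>T. w (inv (fst (fst x)) \<circ> snd (fst x)))"
    unfolding T_def using fin
    by (subst sum_fst_Sigma[where g = "\<lambda>x. w (inv (fst x) \<circ> snd x)"])
      (auto simp: finite_mids intro!: sum.cong)
  also have "\<dots> = (\<Sum>x\<in>T. w (inv (fst (fst (f x))) \<circ> snd (fst (f x))))"
    using f_props by (intro sum.cong) auto
  also have "\<dots> = (\<Sum>x\<in>f ` T. w (inv (fst (fst x)) \<circ> snd (fst x)))"
    using inj by (simp add: sum.reindex)
  also have "\<dots> \<le> (\<Sum>x\<in>U. w (inv (fst (fst x)) \<circ> snd (fst x)))"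
    using finU f_props by (intro sum_mono2) (auto simp: w_def)
  also have "\<dots> = (\<Sum>(m, m')\<in>M \<times> M. real (card (C m m')) / real (card (mids n (inv m \<circ> m'))))"
    unfolding U_def using fin
    by (subst sum_fst_Sigma[where g = "\<lambda>x. w (inv (fst x) \<circ> snd x)"])
      (auto simp: finite_mids C_def w_def intro!: sum.cong)
  also have "\<dots> \<le> (\<Sum>(m, m')\<in>M \<times> M. \<delta>)"
  proof (intro sum_mono, clarify)
    fix m m' assume "m \<in> M" "m' \<in> M"
    then have "m permutes {1..n}" "(inv m \<circ> m') permutes {1..n}"
      using perm by (auto intro!: permutes_compose permutes_inv)
    then show "real (card (C m m')) / real (card (mids n (inv m \<circ> m'))) \<le> \<delta>"
      unfolding C_def \<delta>_def by (intro crossover_bound assms)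
  qed
  also have "\<dots> = (real (card M))\<^sup>2 * \<delta>"
    by (simp add: card_cartesian_product power2_eq_square)
  finally have main: "real (card A) * real (card B) \<le> (real (card M))\<^sup>2 * \<delta>" .
  have pos: "0 < real (card A)" "0 < real (card B)"
    using assms(6,8) fin by (simp_all add: card_gt_0_iff)
  then have "0 < real (card A) * real (card B)" by simp
  then have "0 < (real (card M))\<^sup>2 * \<delta>" using main by linarith
  \<comment> \<open>That \<open>M\<close> is nonempty is read off from the inequality, whose left
    side is positive.\<close>
  then have posM: "0 < real (card M)" by (auto simp: zero_less_mult_iff)
  have "ln (real (card A)) + ln (real (card B)) = ln (real (card A) * real (card B))"
    using pos by (simp add: ln_mult)
  also have "\<dots> \<le> ln ((real (card M))\<^sup>2 * \<delta>)"
    using main pos by (intro ln_mono) auto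
  also have "\<dots> = 2 * ln (real (card M)) - \<epsilon> * (real (cset_dist n A B))\<^sup>2 / (real n - 1)"
    using posM by (simp add: ln_mult \<delta>_def ln_realpow)
  finally have "ln (real (card A)) + ln (real (card B))
      \<le> 2 * ln (real (card M)) - \<epsilon> * (real (cset_dist n A B))\<^sup>2 / (real n - 1)" .
  \<comment> \<open>Halving the logarithmic inequality leaves the coefficient
    \<open>\<epsilon> / (2 * (n - 1))\<close>, which is \<open>K / 8\<close>.\<close>
  moreover have "K / 8 * (real (cset_dist n A B))\<^sup>2
      = 1/2 * (\<epsilon> * (real (cset_dist n A B))\<^sup>2 / (real n - 1))"
    unfolding assms(4) using assms(1) by (simp add: divide_simps)
  ultimately show ?thesis unfolding M_def by linarith
qed

end
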